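(* Let $n\ge 27$. For each integer $a$ with $3\le a\le \lfloor (n-15)/3\rfloor$ and $n-a\equiv 0\pmod 2$, every integer in the interval $\left[\binom{a-1}{2}+1,\ \binom{a}{2}\right]$ is an eigenvalue of $\mathrm{Cay}(S_n,T_n)$.
   Context: $S_n$ is the symmetric group on $\{1,\dots,n\}$ and $T_n\subseteq S_n$ is the set of all transpositions. The transposition graph $\mathrm{Cay}(S_n,T_n)$ is the Cayley graph with vertex set $S_n$ in which $f,g\in S_n$ are adjacent iff $fg^{-1}\in T_n$. Its eigenvalues are the eigenvalues of its adjacency matrix. *)

theory Defs
  imports
    "HOL-Algebra.Sym_Groups"
    "HOL-Number_Theory.Cong"
    "Graph_Theory.Pair_Digraph"
    "Jordan_Normal_Form.Char_Poly"
begin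

definition cayley_graph :: "('a, 'b) monoid_scheme \<Rightarrow> 'a set \<Rightarrow> 'a pair_pre_digraph" where
  "cayley_graph G T =
     \<lparr> pverts = carrier G,
       parcs = {(f, g). f \<in> carrier G \<and> g \<in> carrier G \<and> f \<otimes>\<^bsub>G\<^esub> inv\<^bsub>G\<^esub> g \<in> T} \<rparr>"

definition transpositions :: "nat \<Rightarrow> (nat \<Rightarrow> nat) set" where
  "transpositions n = {transpose i j | i j. i \<in> {1..n} \<and> j \<in> {1..n} \<and> i \<noteq> j}"

text \<open>The adjacency matrix is taken with respect to an enumeration \<open>vs\<close> of the vertices.\<close>

definition adjacency_matrix :: "'a pair_pre_digraph \<Rightarrow> 'a list \<Rightarrow> real mat" where
  "adjacency_matrix G vs =
     mat (length vs) (length vs) (\<lambda>(i, j). if (vs ! i, vs ! j) \<in> parcs G then 1 else 0)"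

text \<open>
  Different enumerations give matrices that are conjugate by a permutation matrix, so
  quantifying universally or existentially over enumerations makes no difference;
  finiteness of the vertex set guarantees that an enumeration exists.
\<close>

definition graph_eigenvalue :: "'a pair_pre_digraph \<Rightarrow> real \<Rightarrow> bool" where
  "graph_eigenvalue G k \<longleftrightarrow>
     finite (pverts G) \<and>
     (\<forall>vs. distinct vs \<and> set vs = pverts G \<longrightarrow> eigenvalue (adjacency_matrix G vs) k)"

end

theory Submission
  imports Defs
begin

text \<open>
  Let \<open>a\<close> and \<open>b\<close> be the row symmetrizer and the column antisymmetrizer of a filling of a Young
  diagram. The sum of all transpositions is central, so multiplying it with \<open>a b\<close> gives the sum
  of the \<open>a t b\<close>. Here \<open>a t b\<close> is \<open>a b\<close> if \<open>t\<close> preserves rows and \<open>- a b\<close> if it preserves columns.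
  If \<open>t\<close> swaps cells \<open>x\<close> and \<open>y\<close> in different rows and columns, the diagram contains a cell \<open>z\<close> in
  the row of one and the column of the other, and \<open>(x z) t = t (y z)\<close> forces \<open>a t b = 0\<close>. Hence
  \<open>a b\<close> is an eigenvector, and its eigenvalue is the sum of the contents of the diagram.

  It remains to find diagrams; now \<open>a\<close> is the number of the theorem. In Frobenius coordinates \<open>(A | B)\<close> the content sum is
  \<open>\<Sum>x\<in>A. x (x + 1) / 2\<close> minus the same sum over \<open>B\<close>. The coordinates \<open>(a - 1, v, z | v, z, 0)\<close> give
  \<open>a choose 2\<close>, and \<open>(a - 1, u, v, z | u + 1, v, z, 0)\<close> give \<open>(a choose 2) - (u + 1)\<close>; the size is
  adjusted to \<open>n\<close> through \<open>v + z\<close>.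
\<close>

section \<open>Diagrams with prescribed Frobenius coordinates\<close>

text \<open>Induction on the number of diagonal cells: the largest coordinates of \<open>A\<close>
  and \<open>B\<close> form the outer hook, and the diagram of the rest is shifted one step down the
  diagonal, which keeps contents. The bounds on \<open>i\<close> and \<open>j\<close> are carried
  along so that the shifted diagram fits inside the hook.\<close>

lemma down_closed_diagram_of_Frobenius_coordinates:
  fixes A B :: "nat set"
  assumes "finite A" "finite B" "card A = card B"
  shows "\<exists>D :: (nat \<times> nat) set. finite D
    \<and> (\<forall>i j i' j'. (i, j) \<in> D \<longrightarrow> i' \<le> i \<longrightarrow> j' \<le> j \<longrightarrow> (i', j') \<in> D)
    \<and> (\<forall>i j. (i, j) \<in> D \<longrightarrow> (\<exists>x\<in>A. j \<le> x) \<and> (\<exists>y\<in>B. i \<le> y))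
    \<and> card D = \<Sum>A + \<Sum>B + card A
    \<and> (\<Sum>(i, j)\<in>D. int j - int i) =
        (\<Sum>x\<in>A. int (Suc x choose 2)) - (\<Sum>y\<in>B. int (Suc y choose 2))"
  using assms
proof (induction "card A" arbitrary: A B)
  case 0
  then have "A = {}" "B = {}" by auto
  then show ?case by (intro exI[of _ "{}"]) auto
next
  case (Suc d)
  define x y where "x = Max A" and "y = Max B"
  have ne: "A \<noteq> {}" "B \<noteq> {}" using Suc.hyps Suc.prems by auto
  have xA: "x \<in> A" and yB: "y \<in> B" using Suc.prems ne by (auto simp: x_def y_def)
  have xmax: "z < x" if "z \<in> A - {x}" for z
    using that Suc.prems(1) Max_ge[of A z] by (auto simp: x_def order.strict_iff_order)
  have ymax: "z < y" if "z \<in> B - {y}" for z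
    using that Suc.prems(2) Max_ge[of B z] by (auto simp: y_def order.strict_iff_order)
  have "d = card (A - {x})" "card (A - {x}) = card (B - {y})"
    using Suc.hyps Suc.prems xA yB by auto
  from Suc.hyps(1)[OF this(1) finite_Diff[OF Suc.prems(1)] finite_Diff[OF Suc.prems(2)] this(2)]
  obtain D where D: "finite D"
      "\<forall>i j i' j'. (i, j) \<in> D \<longrightarrow> i' \<le> i \<longrightarrow> j' \<le> j \<longrightarrow> (i', j') \<in> D"
      "\<forall>i j. (i, j) \<in> D \<longrightarrow> (\<exists>z\<in>A - {x}. j \<le> z) \<and> (\<exists>z\<in>B - {y}. i \<le> z)"
      "card D = \<Sum>(A - {x}) + \<Sum>(B - {y}) + card (A - {x})"
      "(\<Sum>(i, j)\<in>D. int j - int i) =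
        (\<Sum>z\<in>A - {x}. int (Suc z choose 2)) - (\<Sum>z\<in>B - {y}. int (Suc z choose 2))"
    by (elim exE conjE)
  \<comment> \<open>The corner belongs to \<open>arm\<close> and not to \<open>leg\<close>, so the
    contents are 0 to \<open>x\<close> on the arm and -1 to -\<open>y\<close> on the leg.\<close>
  define arm where "arm = (\<lambda>j. (0::nat, j)) ` {..x}"
  define leg where "leg = (\<lambda>i. (i, 0::nat)) ` {1..y}"
  define core where "core = (\<lambda>(i, j). (Suc i, Suc j)) ` D"
  define E where "E = arm \<union> leg \<union> core"
  \<comment> \<open>Strict because the maxima have been removed; after the shift by one the core
    still lies in rows up to \<open>y\<close> and columns up to \<open>x\<close>, which gives
    down-closure of \<open>E\<close>.\<close>
  have lt: "i < y \<and> j < x" if "(i, j) \<in> D" for i j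
    using D(3) that xmax ymax by (meson le_less_trans)
  have mem: "(i, j) \<in> E \<longleftrightarrow> (i = 0 \<and> j \<le> x) \<or> (j = 0 \<and> i \<le> y)
      \<or> (\<exists>i' j'. i = Suc i' \<and> j = Suc j' \<and> (i', j') \<in> D)" for i j
    by (cases i) (auto simp: E_def arm_def leg_def core_def)
  have fin: "finite arm" "finite leg" "finite core"
    using D(1) by (auto simp: arm_def leg_def core_def)
  have disj: "arm \<inter> leg = {}" "(arm \<union> leg) \<inter> core = {}"
    by (auto simp: arm_def leg_def core_def)
  have inj: "inj_on (\<lambda>(i, j). (Suc i, Suc j)) D" by (auto simp: inj_on_def)
  have "card arm = Suc x" "card leg = y" "card core = card D"
    using inj by (auto simp: arm_def leg_def core_def card_image inj_on_def)
  then have "card E = Suc x + y + card D"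
    using fin disj by (simp add: E_def card_Un_disjoint)
  moreover have "\<Sum>A = x + \<Sum>(A - {x})" "\<Sum>B = y + \<Sum>(B - {y})" "card A = Suc (card (A - {x}))"
    using sum.remove[OF Suc.prems(1) xA, of "\<lambda>z. z"] sum.remove[OF Suc.prems(2) yB, of "\<lambda>z. z"]
      card.remove[OF Suc.prems(1) xA] by simp_all
  ultimately have cardE: "card E = \<Sum>A + \<Sum>B + card A" using D(4) by simp
  have sums: "(\<Sum>(i, j)\<in>arm. int j - int i) = int (Suc x choose 2)"
    "(\<Sum>(i, j)\<in>leg. int j - int i) = - int (Suc y choose 2)"
    "(\<Sum>(i, j)\<in>core. int j - int i) = (\<Sum>(i, j)\<in>D. int j - int i)"
  proof -
    have T: "(\<Sum>j\<le>k. int j) = int (Suc k choose 2)" for k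
      by (induction k) (auto simp: numeral_2_eq_2)
    show "(\<Sum>(i, j)\<in>arm. int j - int i) = int (Suc x choose 2)"
      unfolding arm_def by (subst sum.reindex) (auto simp: inj_on_def T)
    have "(\<Sum>i\<in>{1..y}. int i) = (\<Sum>i\<le>y. int i)"
      by (rule sum.mono_neutral_left) auto
    then show "(\<Sum>(i, j)\<in>leg. int j - int i) = - int (Suc y choose 2)"
      unfolding leg_def by (subst sum.reindex) (auto simp: inj_on_def T sum_negf)
    show "(\<Sum>(i, j)\<in>core. int j - int i) = (\<Sum>(i, j)\<in>D. int j - int i)"
      unfolding core_def by (subst sum.reindex[OF inj]) (auto intro!: sum.cong)
  qed
  have "(\<Sum>(i, j)\<in>E. int j - int i) =
      int (Suc x choose 2) - int (Suc y choose 2) + (\<Sum>(i, j)\<in>D. int j - int i)"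
    unfolding E_def using fin disj sums by (simp add: sum.union_disjoint)
  also have "\<dots> = (\<Sum>z\<in>A. int (Suc z choose 2)) - (\<Sum>z\<in>B. int (Suc z choose 2))"
    using D(5) sum.remove[OF Suc.prems(1) xA, of "\<lambda>z. int (Suc z choose 2)"]
      sum.remove[OF Suc.prems(2) yB, of "\<lambda>z. int (Suc z choose 2)"] by linarith
  finally have sumE: "(\<Sum>(i, j)\<in>E. int j - int i) =
    (\<Sum>z\<in>A. int (Suc z choose 2)) - (\<Sum>z\<in>B. int (Suc z choose 2))" .
  have closed: "(i', j') \<in> E" if h: "(i, j) \<in> E" "i' \<le> i" "j' \<le> j" for i j i' j'
  proof (cases "i' = 0 \<or> j' = 0")
    case True
    have "i \<le> y \<and> j \<le> x" using h(1) lt unfolding mem by fastforce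
    then show ?thesis using True h unfolding mem by auto
  next
    case False
    then obtain k l where kl: "i' = Suc k" "j' = Suc l" by (metis not0_implies_Suc)
    then obtain k' l' where "i = Suc k'" "j = Suc l'" "(k', l') \<in> D"
      using h unfolding mem by auto
    then show ?thesis using kl h D(2) unfolding mem by auto
  qed
  have bound: "(\<exists>z\<in>A. j \<le> z) \<and> (\<exists>z\<in>B. i \<le> z)" if h: "(i, j) \<in> E" for i j
  proof -
    have "i \<le> y \<and> j \<le> x" using h lt unfolding mem by fastforce
    then show ?thesis using xA yB by blast
  qed
  show ?case
  proof (intro exI[of _ E] conjI allI impI)
    show "finite E" using fin by (simp add: E_def)
  qed (use closed bound cardE sumE in blast)+
qed

text \<open>For \<open>M\<close> at least 9 the pairs \<open>{v, M - v}\<close> with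
  \<open>v\<close> from 1 to 4 are disjoint, and three forbidden numbers can spoil at most three of
  them.\<close>

lemma distinct_summands_avoiding_three:
  fixes M p q r :: nat
  assumes "M \<ge> 9"
  shows "\<exists>v z. v + z = M \<and> 0 < v \<and> v < z \<and> {v, z} \<inter> {p, q, r} = {}"
proof -
  \<comment> \<open>Sends both members of a pair to the smaller one; numbers above \<open>M\<close>
    go to 0 by truncated subtraction and spoil no pair.\<close>
  define \<phi> where "\<phi> x = min x (M - x)" for x
  have "card {\<phi> p, \<phi> q, \<phi> r} \<le> 3"
    using card_insert_le_m1[of 3 "{\<phi> q, \<phi> r}" "\<phi> p"] card_insert_le_m1[of 2 "{\<phi> r}" "\<phi> q"]
    by simp
  then have "\<not> {1..4} \<subseteq> {\<phi> p, \<phi> q, \<phi> r}"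
    using card_mono[of "{\<phi> p, \<phi> q, \<phi> r}" "{1..4}"] by auto
  then obtain v where v: "1 \<le> v" "v \<le> 4" "v \<notin> {\<phi> p, \<phi> q, \<phi> r}"
    unfolding subset_iff atLeastAtMost_iff by blast
  have "\<phi> v = v" "\<phi> (M - v) = v" using v assms by (auto simp: \<phi>_def)
  with v have "{v, M - v} \<inter> {p, q, r} = {}" by force
  with v assms show ?thesis by (intro exI[of _ v] exI[of _ "M - v"]) auto
qed

section \<open>Young symmetrizers as eigenvectors\<close>

text \<open>Labels in \<open>S\<close> stand for cells through zero-based coordinates, so
  permutations act directly on labels.\<close>

locale young_filling =
  fixes S :: "'a set" and r c :: "'a \<Rightarrow> nat"
  assumes finite_S: "finite S"
    and cell_inj: "\<And>x y. x \<in> S \<Longrightarrow> y \<in> S \<Longrightarrow> r x = r y \<Longrightarrow> c x = c y \<Longrightarrow> x = y"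
    and down_closed: "\<And>x i j. x \<in> S \<Longrightarrow> i \<le> r x \<Longrightarrow> j \<le> c x \<Longrightarrow> \<exists>z\<in>S. r z = i \<and> c z = j"
begin

text \<open>One notion for both groups: \<open>stab r\<close> is the row group and
  \<open>stab c\<close> the column group.\<close>

definition stab :: "('a \<Rightarrow> nat) \<Rightarrow> ('a \<Rightarrow> 'a) set" where
  "stab h = {p. p permutes S \<and> (\<forall>x\<in>S. h (p x) = h x)}"

definition transps :: "('a \<Rightarrow> 'a) set" where
  "transps = {transpose x y | x y. x \<in> S \<and> y \<in> S \<and> x \<noteq> y}"

text \<open>The coefficient of \<open>g\<close> in \<open>a t b\<close>, for the row symmetrizer \<open>a\<close> and column antisymmetrizer \<open>b\<close>.\<close>

definition sandwich :: "('a \<Rightarrow> 'a) \<Rightarrow> ('a \<Rightarrow> 'a) \<Rightarrow> int" where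
  "sandwich t g = (\<Sum>p\<in>stab r. \<Sum>q\<in>stab c. if p \<circ> t \<circ> q = g then sign q else 0)"

section \<open>Row and column groups and their absorption into the symmetrizer\<close>

lemma finite_stab: "finite (stab h)"
  unfolding stab_def by (rule finite_subset[OF _ finite_permutations[OF finite_S]]) auto

lemma stab_id: "id \<in> stab h"
  by (simp add: stab_def permutes_id)

lemma stab_comp: "p \<in> stab h \<Longrightarrow> q \<in> stab h \<Longrightarrow> p \<circ> q \<in> stab h"
  by (auto simp: stab_def permutes_compose permutes_in_image)

lemma stab_inv:
  assumes "p \<in> stab h" shows "inv' p \<in> stab h"
proof -
  have p: "p permutes S" and h: "\<And>x. x \<in> S \<Longrightarrow> h (p x) = h x"
    using assms by (auto simp: stab_def)
  have "h (inv' p x) = h x" if "x \<in> S" for x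
    using h[of "inv' p x"] that p permutes_in_image[OF permutes_inv[OF p]]
    by (simp add: permutes_inverses)
  then show ?thesis using permutes_inv[OF p] by (simp add: stab_def)
qed

lemma permutation_of_permutes_S: "p permutes S \<Longrightarrow> permutation p"
  using finite_S permutation_permutes by blast

lemma bij_stab_right:
  assumes "s \<in> stab h" shows "bij_betw (\<lambda>p. p \<circ> s) (stab h) (stab h)"
proof (rule bij_betwI[where g = "\<lambda>p. p \<circ> inv' s"])
  have "s permutes S" using assms by (simp add: stab_def)
  then show "p \<circ> s \<circ> inv' s = p" "p \<circ> inv' s \<circ> s = p" for p
    by (simp_all add: comp_assoc permutes_inv_o)
qed (use assms stab_comp stab_inv in auto)

lemma bij_stab_left:
  assumes "s \<in> stab h" shows "bij_betw (\<lambda>p. s \<circ> p) (stab h) (stab h)"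
proof (rule bij_betwI[where g = "\<lambda>p. inv' s \<circ> p"])
  have "s permutes S" using assms by (simp add: stab_def)
  then show "inv' s \<circ> (s \<circ> p) = p" "s \<circ> (inv' s \<circ> p) = p" for p
    by (simp_all add: permutes_inv_o flip: comp_assoc)
qed (use assms stab_comp stab_inv in auto)

text \<open>This is \<open>a s = a\<close>: right translation by \<open>s\<close> permutes the row
  group.\<close>

lemma sandwich_row:
  assumes "s \<in> stab r" shows "sandwich (s \<circ> t) g = sandwich t g"
  unfolding sandwich_def
  by (subst (2) sum.reindex_bij_betw[OF bij_stab_right[OF assms], symmetric])
     (simp add: comp_assoc)

text \<open>This is \<open>s b = sign s * b\<close>; the sign changes sides because its square is
  1.\<close>

lemma sandwich_column:
  assumes "s \<in> stab c" shows "sandwich (t \<circ> s) g = sign s * sandwich t g"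
proof -
  have s: "permutation s" using assms by (simp add: stab_def permutation_of_permutes_S)
  have "(\<Sum>q\<in>stab c. if p \<circ> t \<circ> q = g then sign q else 0)
      = sign s * (\<Sum>q\<in>stab c. if p \<circ> (t \<circ> s) \<circ> q = g then sign q else 0)" for p
  proof -
    have "(\<Sum>q\<in>stab c. if p \<circ> t \<circ> q = g then sign q else 0)
       = (\<Sum>q\<in>stab c. if p \<circ> t \<circ> (s \<circ> q) = g then sign (s \<circ> q) else 0)"
      by (rule sum.reindex_bij_betw[OF bij_stab_left[OF assms], symmetric])
    also have "\<dots> = (\<Sum>q\<in>stab c. sign s * (if p \<circ> (t \<circ> s) \<circ> q = g then sign q else 0))"
    proof (rule sum.cong[OF refl])
      fix q assume "q \<in> stab c"
      then have "permutation q" by (simp add: stab_def permutation_of_permutes_S)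
      then show "(if p \<circ> t \<circ> (s \<circ> q) = g then sign (s \<circ> q) else 0)
          = sign s * (if p \<circ> (t \<circ> s) \<circ> q = g then sign q else 0)"
        by (simp add: sign_compose[OF s] comp_assoc)
    qed
    finally show ?thesis by (simp add: sum_distrib_left)
  qed
  then have "sandwich t g = sign s * sandwich (t \<circ> s) g"
    by (simp add: sandwich_def sum_distrib_left)
  moreover have "sign s * sign s = 1" by simp
  ultimately show ?thesis by (metis mult.assoc mult_1)
qed

section \<open>Transpositions between the two factors\<close>

lemma transpose_in_stab:
  assumes "x \<in> S" "y \<in> S" "h x = h y" shows "transpose x y \<in> stab h"
  using assms permutes_swap_id[of x S y] by (auto simp: stab_def transpose_def)

lemma transpose_in_stab_iff:
  assumes "x \<in> S" "y \<in> S" shows "transpose x y \<in> stab h \<longleftrightarrow> h x = h y"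
  using assms transpose_in_stab[OF assms] by (fastforce simp: stab_def)

lemma stab_row_column_trivial:
  assumes "p \<in> stab r" "p \<in> stab c" shows "p = id"
proof
  fix x
  show "p x = id x"
  proof (cases "x \<in> S")
    case True
    with assms show ?thesis by (auto simp: stab_def permutes_in_image intro!: cell_inj)
  next
    case False
    with assms show ?thesis by (auto simp: stab_def permutes_not_in)
  qed
qed

text \<open>The row swap of \<open>x\<close> and \<open>z\<close> is absorbed on the left without a
  sign, the column swap of \<open>y\<close> and \<open>z\<close> on the right with sign -1, so the
  coefficient equals its own negative.\<close>

lemma sandwich_eq_0:
  assumes "x \<in> S" "y \<in> S" "z \<in> S" "r z = r x" "c z = c y" "r x \<noteq> r y" "c x \<noteq> c y"
  shows "sandwich (transpose x y) g = 0"
proof -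
  have ne: "x \<noteq> y" "z \<noteq> x" "z \<noteq> y" using assms by auto
  have "transpose x z \<circ> transpose x y = transpose x y \<circ> transpose y z"
    using ne by (auto simp: fun_eq_iff transpose_def)
  then have "sandwich (transpose x y) g = sandwich (transpose x y \<circ> transpose y z) g"
    using sandwich_row[OF transpose_in_stab[of x z r]] assms by metis
  also have "\<dots> = - sandwich (transpose x y) g"
    using sandwich_column[OF transpose_in_stab[of y z c]] assms ne by (simp add: sign_swap_id)
  finally show ?thesis by simp
qed

lemma sandwich_transpose:
  assumes "x \<in> S" "y \<in> S" "x \<noteq> y"
  shows "sandwich (transpose x y) g =
    (of_bool (r x = r y) - of_bool (c x = c y)) * sandwich id g"
proof -
  consider "r x = r y" "c x \<noteq> c y" | "c x = c y" "r x \<noteq> r y" | "r x \<noteq> r y" "c x \<noteq> c y"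
    using assms cell_inj by blast
  then show ?thesis
  proof cases
    case 1
    then show ?thesis using sandwich_row[OF transpose_in_stab[of x y r], of id] assms by simp
  next
    case 2
    then show ?thesis
      using sandwich_column[OF transpose_in_stab[of x y c], of id] assms by (simp add: sign_swap_id)
  next
    case 3
    have "sandwich (transpose x y) g = 0"
    \<comment> \<open>The corner of the rectangle that takes the smaller row and the column of the
      other cell is in the diagram by down-closure.\<close>
    proof (cases "r x < r y")
      case True
      then obtain z where "z \<in> S" "r z = r x" "c z = c y"
        using down_closed[of y "r x" "c y"] assms by auto
      then show ?thesis using sandwich_eq_0[of x y z] assms 3 by simp
    next
      case False
      then obtain z where "z \<in> S" "r z = r y" "c z = c x"
        using down_closed[of x "r y" "c x"] assms 3 by auto
      then show ?thesis using sandwich_eq_0[of y x z] assms 3 by (simp add: transpose_commute)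
    qed
    then show ?thesis using 3 by simp
  qed
qed

section \<open>Conjugation and counting of transpositions\<close>

lemma finite_transps: "finite transps"
  unfolding transps_def
  by (rule finite_subset[of _ "(\<lambda>(x, y). transpose x y) ` (S \<times> S)"]) (use finite_S in auto)

lemma transps_involution: "t \<in> transps \<Longrightarrow> t \<circ> t = id"
  by (auto simp: transps_def)

lemma conj_transps:
  assumes "p permutes S" "t \<in> transps" shows "inv' p \<circ> t \<circ> p \<in> transps"
proof -
  obtain x y where xy: "t = transpose x y" "x \<in> S" "y \<in> S" "x \<noteq> y"
    using assms by (auto simp: transps_def)
  have b: "bij p" using assms(1) permutes_bij by blast
  have "inv' p \<circ> t \<circ> p = transpose (inv' p x) (inv' p y)"
  proof
    fix w
    show "(inv' p \<circ> t \<circ> p) w = transpose (inv' p x) (inv' p y) w"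
      using assms(1) b xy(1)
      by (auto simp: transpose_def permutes_inverses bij_inv_eq_iff)
  qed
  moreover have "inv' p x \<in> S" "inv' p y \<in> S" "inv' p x \<noteq> inv' p y"
    using xy assms(1) permutes_in_image[OF permutes_inv[OF assms(1)]]
    by (auto simp: inj_eq[OF permutes_inj[OF permutes_inv]])
  ultimately show ?thesis by (auto simp: transps_def)
qed

lemma bij_conj_transps:
  assumes "p permutes S" shows "bij_betw (\<lambda>t. inv' p \<circ> t \<circ> p) transps transps"
proof (rule bij_betwI[where g = "\<lambda>t. p \<circ> t \<circ> inv' p"])
  show "(\<lambda>t. inv' p \<circ> t \<circ> p) \<in> transps \<rightarrow> transps" using conj_transps[OF assms] by auto
  show "(\<lambda>t. p \<circ> t \<circ> inv' p) \<in> transps \<rightarrow> transps"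
    using conj_transps[OF permutes_inv[OF assms]] permutes_inv_inv[OF assms] by auto
  show "p \<circ> (inv' p \<circ> t \<circ> p) \<circ> inv' p = t" "inv' p \<circ> (p \<circ> t \<circ> inv' p) \<circ> p = t" for t
    using assms by (auto simp: fun_eq_iff permutes_inverses)
qed

text \<open>Centrality of the sum of all transpositions moves it between the two factors of the
  symmetrizer.\<close>

lemma sum_symmetrizer_neighbours:
  "(\<Sum>t\<in>transps. sandwich id (t \<circ> g)) = (\<Sum>t\<in>transps. sandwich t g)"
proof -
  have "(\<Sum>t\<in>transps. sandwich id (t \<circ> g)) =
      (\<Sum>p\<in>stab r. \<Sum>t\<in>transps. \<Sum>q\<in>stab c. if p \<circ> q = t \<circ> g then sign q else 0)"
    unfolding sandwich_def by (subst sum.swap) simp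
  also have "\<dots> = (\<Sum>p\<in>stab r. \<Sum>t\<in>transps. \<Sum>q\<in>stab c. if p \<circ> t \<circ> q = g then sign q else 0)"
  proof (rule sum.cong[OF refl])
    fix p assume "p \<in> stab r"
    then have p: "p permutes S" by (simp add: stab_def)
    \<comment> \<open>Since \<open>t\<close> is an involution, \<open>p q = t g\<close> means
      \<open>t p q = g\<close>, and \<open>t p = p (inv' p t p)\<close> puts a conjugate of
      \<open>t\<close> between the factors.\<close>
    have "p \<circ> q = t \<circ> g \<longleftrightarrow> p \<circ> (inv' p \<circ> t \<circ> p) \<circ> q = g" if "t \<in> transps" for t q
    proof -
      have "p \<circ> (inv' p \<circ> t \<circ> p) \<circ> q = t \<circ> (p \<circ> q)"
        using p by (auto simp: fun_eq_iff permutes_inverses)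
      moreover have "t \<circ> (t \<circ> h) = h" for h
        using transps_involution[OF that] by (metis comp_assoc id_comp)
      ultimately show ?thesis by metis
    qed
    then have "(\<Sum>t\<in>transps. \<Sum>q\<in>stab c. if p \<circ> q = t \<circ> g then sign q else 0) =
      (\<Sum>t\<in>transps. \<Sum>q\<in>stab c. if p \<circ> (inv' p \<circ> t \<circ> p) \<circ> q = g then sign q else 0)"
      by (intro sum.cong refl if_cong) auto
    also have "\<dots> = (\<Sum>t\<in>transps. \<Sum>q\<in>stab c. if p \<circ> t \<circ> q = g then sign q else 0)"
      by (rule sum.reindex_bij_betw[OF bij_conj_transps[OF p]])
    finally show "(\<Sum>t\<in>transps. \<Sum>q\<in>stab c. if p \<circ> q = t \<circ> g then sign q else 0) =
        (\<Sum>t\<in>transps. \<Sum>q\<in>stab c. if p \<circ> t \<circ> q = g then sign q else 0)" .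
  qed
  also have "\<dots> = (\<Sum>t\<in>transps. sandwich t g)"
    unfolding sandwich_def by (rule sum.swap)
  finally show ?thesis .
qed

text \<open>Each swap within a line of constant \<open>h\<close> is counted at its endpoint with
  larger \<open>k\<close>; a cell \<open>x\<close> has exactly \<open>k x\<close> predecessors in
  its line. Used with \<open>(h, k)\<close> equal to \<open>(r, c)\<close> and to
  \<open>(c, r)\<close>.\<close>

lemma card_transps_stab:
  fixes h k :: "'a \<Rightarrow> nat"
  assumes inj: "\<And>x y. x \<in> S \<Longrightarrow> y \<in> S \<Longrightarrow> h x = h y \<Longrightarrow> k x = k y \<Longrightarrow> x = y"
    and closed: "\<And>x j. x \<in> S \<Longrightarrow> j \<le> k x \<Longrightarrow> \<exists>z\<in>S. h z = h x \<and> k z = j"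
  shows "card (transps \<inter> stab h) = (\<Sum>x\<in>S. k x)"
proof -
  define P where "P = (SIGMA x:S. {y \<in> S. h y = h x \<and> k y < k x})"
  have "bij_betw (\<lambda>(x, y). transpose x y) P (transps \<inter> stab h)"
  proof (rule bij_betw_imageI)
    show "inj_on (\<lambda>(x, y). transpose x y) P"
    proof (rule inj_onI, clarify)
      fix x y x' y'
      assume a: "(x, y) \<in> P" "(x', y') \<in> P" "transpose x y = transpose x' y'"
      have lt: "k y < k x" "k y' < k x'" using a by (auto simp: P_def)
      \<comment> \<open>Evaluation at the moved point \<open>x\<close> identifies the unordered
        pairs; the orientation by \<open>k\<close> then excludes the reversed order.\<close>
      have "transpose x' y' x = y" using fun_cong[OF a(3), of x] by simp
      moreover have "x \<noteq> y" using lt by auto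
      ultimately have "x = x' \<and> y = y' \<or> x = y' \<and> y = x'"
        by (auto simp: transpose_def split: if_splits)
      then show "x = x' \<and> y = y'" using lt by auto
    qed
    show "(\<lambda>(x, y). transpose x y) ` P = transps \<inter> stab h"
    proof (intro equalityI subsetI)
      fix t assume "t \<in> (\<lambda>(x, y). transpose x y) ` P"
      then show "t \<in> transps \<inter> stab h"
        by (auto simp: P_def transps_def transpose_in_stab_iff)
    next
      fix t assume t: "t \<in> transps \<inter> stab h"
      then obtain x y where xy: "t = transpose x y" "x \<in> S" "y \<in> S" "x \<noteq> y"
        by (auto simp: transps_def)
      then have "h x = h y" using t transpose_in_stab_iff by auto
      then have "(x, y) \<in> P \<or> (y, x) \<in> P" using xy inj[of x y] by (fastforce simp: P_def)
      then show "t \<in> (\<lambda>(x, y). transpose x y) ` P"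
        using xy(1) by (force simp: transpose_commute)
    qed
  qed
  then have "card (transps \<inter> stab h) = card P" by (simp add: bij_betw_same_card)
  also have "\<dots> = (\<Sum>x\<in>S. card {y \<in> S. h y = h x \<and> k y < k x})"
    unfolding P_def by (rule card_SigmaI) (use finite_S in auto)
  also have "\<dots> = (\<Sum>x\<in>S. k x)"
  proof (rule sum.cong[OF refl])
    fix x assume x: "x \<in> S"
    have "bij_betw k {y \<in> S. h y = h x \<and> k y < k x} {..<k x}"
    proof (rule bij_betw_imageI)
      show "inj_on k {y \<in> S. h y = h x \<and> k y < k x}" by (auto intro!: inj_onI inj)
      show "k ` {y \<in> S. h y = h x \<and> k y < k x} = {..<k x}"
      proof (intro equalityI subsetI)
        fix j assume "j \<in> {..<k x}"
        then obtain z where "z \<in> S" "h z = h x" "k z = j" "j < k x"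
          using closed[OF x, of j] by auto
        then show "j \<in> k ` {y \<in> S. h y = h x \<and> k y < k x}" by auto
      qed auto
    qed
    then show "card {y \<in> S. h y = h x \<and> k y < k x} = k x" by (simp add: bij_betw_same_card)
  qed
  finally show ?thesis .
qed

text \<open>Row swaps count +1, column swaps -1 and all others 0, so the factor is the number of row
  swaps minus the number of column swaps.\<close>

lemma symmetrizer_eigenfunction:
  "(\<Sum>t\<in>transps. sandwich id (t \<circ> g)) = (\<Sum>x\<in>S. int (c x) - int (r x)) * sandwich id g"
proof -
  have "(\<Sum>t\<in>transps. sandwich id (t \<circ> g)) =
      (\<Sum>t\<in>transps. (of_bool (t \<in> stab r) - of_bool (t \<in> stab c)) * sandwich id g)"
    unfolding sum_symmetrizer_neighbours
  proof (rule sum.cong[OF refl])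
    fix t assume "t \<in> transps"
    then show "sandwich t g = (of_bool (t \<in> stab r) - of_bool (t \<in> stab c)) * sandwich id g"
      by (auto simp: transps_def sandwich_transpose transpose_in_stab_iff)
  qed
  also have "\<dots> = (int (card (transps \<inter> stab r)) - int (card (transps \<inter> stab c))) * sandwich id g"
    using finite_transps by (simp add: sum_subtractf Int_def flip: sum_distrib_right)
  also have "\<dots> = (\<Sum>x\<in>S. int (c x) - int (r x)) * sandwich id g"
  proof -
    have "card (transps \<inter> stab r) = (\<Sum>x\<in>S. c x)"
      by (rule card_transps_stab) (use cell_inj down_closed in auto)
    moreover have "card (transps \<inter> stab c) = (\<Sum>x\<in>S. r x)"
      by (rule card_transps_stab) (use cell_inj down_closed in fastforce)+
    ultimately show ?thesis by (simp add: sum_subtractf)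
  qed
  finally show ?thesis .
qed

text \<open>Row and column group meet trivially, so only \<open>p = q = id\<close> contributes. This
  ensures that the eigenvector is nonzero.\<close>

lemma symmetrizer_id: "sandwich id id = 1"
proof -
  have "(if p \<circ> id \<circ> q = id then sign q else 0) = (if q = id then if p = id then 1 else 0 else 0)"
    if "p \<in> stab r" "q \<in> stab c" for p q
  proof (cases "p \<circ> q = id")
    case True
    have "q permutes S" using that by (simp add: stab_def)
    then have "p = inv' q" using True
      by (metis comp_assoc comp_id id_comp permutes_inv_o(1))
    then have "p \<in> stab c" using that stab_inv by simp
    then have "p = id" using that stab_row_column_trivial by blast
    then show ?thesis using True by (auto simp: sign_id)
  qed auto
  then have "sandwich id id = (\<Sum>p\<in>stab r. \<Sum>q\<in>stab c. if q = id then if p = id then 1 else 0 else 0)"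
    unfolding sandwich_def by (intro sum.cong refl) auto
  then show ?thesis by (simp add: finite_stab stab_id)
qed

end

section \<open>The transposition graph\<close>

text \<open>After numbering the cells by \<open>1..n\<close>, the coefficients of the Young
  symmetrizer, listed in the order of the vertices, form the eigenvector.\<close>

lemma content_sum_eigenvalue:
  fixes D :: "(nat \<times> nat) set"
  assumes D: "finite D"
    and closed: "\<And>i j i' j'. (i, j) \<in> D \<Longrightarrow> i' \<le> i \<Longrightarrow> j' \<le> j \<Longrightarrow> (i', j') \<in> D"
  shows "graph_eigenvalue (cayley_graph (sym_group (card D)) (transpositions (card D)))
    (of_int (\<Sum>(i, j)\<in>D. int j - int i))"
proof -
  define n where "n = card D"
  define S where "S = {1..n}"
  obtain f where f: "bij_betw f S D"
    using finite_same_card_bij[of S D] D by (auto simp: n_def S_def)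
  interpret young_filling S "fst \<circ> f" "snd \<circ> f"
  proof
    show "x = y" if "x \<in> S" "y \<in> S" "(fst \<circ> f) x = (fst \<circ> f) y"
      "(snd \<circ> f) x = (snd \<circ> f) y" for x y
      by (rule inj_onD[OF bij_betw_imp_inj_on[OF f]]) (use that in \<open>simp_all add: prod_eq_iff\<close>)
    show "\<exists>z\<in>S. (fst \<circ> f) z = i \<and> (snd \<circ> f) z = j"
      if "x \<in> S" "i \<le> (fst \<circ> f) x" "j \<le> (snd \<circ> f) x" for x i j
    proof -
      have "f x \<in> D" using that f bij_betwE by blast
      then have "(i, j) \<in> D" using closed[of "fst (f x)" "snd (f x)" i j] that by simp
      then obtain z where "z \<in> S" "f z = (i, j)"
        using bij_betw_imp_surj_on[OF f] by (metis imageE)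
      then show ?thesis by (intro bexI[of _ z]) auto
    qed
  qed (simp add: S_def)
  define k where "k = (\<Sum>(i, j)\<in>D. int j - int i)"
  have k: "(\<Sum>x\<in>S. int ((snd \<circ> f) x) - int ((fst \<circ> f) x)) = k"
    unfolding k_def using sum.reindex_bij_betw[OF f, of "\<lambda>(i, j). int j - int i"]
    by (simp add: case_prod_beta)
  define G where "G = cayley_graph (sym_group n) (transpositions n)"
  have T: "transpositions n = transps" unfolding transpositions_def transps_def unfolding S_def by (rule refl)
  have verts: "pverts G = {p. p permutes S}"
    by (simp add: G_def cayley_graph_def sym_group_def S_def)
  \<comment> \<open>For an involution \<open>t\<close>, the condition \<open>g h^-1 = t\<close>
    reads \<open>h = t g\<close>: neighbours are left translates by transpositions.\<close>
  have arcs: "(g, h) \<in> parcs G \<longleftrightarrow> h \<in> (\<lambda>t. t \<circ> g) ` transps"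
    if g: "g permutes S" for g h
  proof -
    have inv_eq: "inv\<^bsub>sym_group n\<^esub> h = inv' h" if "h permutes S" for h
      using that sym_group_inv_equality[of h n] by (simp add: sym_group_carrier S_def)
    have tperm: "t permutes S" if "t \<in> transps" for t
      using that by (auto simp: transps_def intro: permutes_swap_id)
    have tt: "t \<circ> (t \<circ> u) = u" if "t \<in> transps" for t and u :: "nat \<Rightarrow> nat"
      using transps_involution[OF that] by (metis comp_assoc id_comp)
    have "(g, h) \<in> parcs G \<longleftrightarrow> h permutes S \<and> g \<circ> inv' h \<in> transps"
      using g inv_eq by (auto simp: G_def cayley_graph_def T sym_group_def S_def)
    also have "\<dots> \<longleftrightarrow> h \<in> (\<lambda>t. t \<circ> g) ` transps"
    proof
      assume h: "h permutes S \<and> g \<circ> inv' h \<in> transps"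
      have "(g \<circ> inv' h) \<circ> ((g \<circ> inv' h) \<circ> h) = h" using tt h by blast
      moreover have "(g \<circ> inv' h) \<circ> h = g"
        by (simp add: comp_assoc permutes_inv_o[OF conjunct1[OF h]])
      ultimately show "h \<in> (\<lambda>t. t \<circ> g) ` transps" using h by (metis image_eqI)
    next
      assume "h \<in> (\<lambda>t. t \<circ> g) ` transps"
      then obtain t where t: "t \<in> transps" "h = t \<circ> g" by auto
      then have h: "h permutes S" using tperm g permutes_compose by blast
      have "g = t \<circ> h" using t tt by simp
      then have "g \<circ> inv' h = t" using h by (simp add: comp_assoc permutes_inv_o)
      then show "h permutes S \<and> g \<circ> inv' h \<in> transps" using h t by simp
    qed
    finally show ?thesis .
  qed
  have eigen: "eigenvalue (adjacency_matrix G vs) (of_int k)"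
    if vs: "distinct vs" "set vs = pverts G" for vs
  proof -
    define A where "A = adjacency_matrix G vs"
    define v :: "real vec" where "v = vec (length vs) (\<lambda>i. of_int (sandwich id (vs ! i)))"
    have dimA: "dim_row A = length vs" "dim_col A = length vs"
      by (auto simp: A_def adjacency_matrix_def)
    have "id \<in> set vs" using vs verts by (simp add: permutes_id)
    then obtain i where i: "i < length vs" "vs ! i = id" by (auto simp: in_set_conv_nth)
    then have "v $ i = 1" by (simp add: v_def symmetrizer_id)
    then have "v \<noteq> 0\<^sub>v (length vs)" using i by auto
    moreover have "A *\<^sub>v v = of_int k \<cdot>\<^sub>v v"
    proof (rule eq_vecI)
      fix i assume "i < dim_vec (of_int k \<cdot>\<^sub>v v)"
      then have i: "i < length vs" by (simp add: v_def)
      define g where "g = vs ! i"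
      have g: "g permutes S" using vs verts i nth_mem[OF i] by (auto simp: g_def)
      have "(A *\<^sub>v v) $ i = (\<Sum>j<length vs. A $$ (i, j) * v $ j)"
        using i dimA by (simp add: scalar_prod_def v_def lessThan_atLeast0)
      also have "\<dots> = (\<Sum>j<length vs. if (g, vs ! j) \<in> parcs G then of_int (sandwich id (vs ! j)) else 0)"
        using i by (intro sum.cong) (auto simp: A_def adjacency_matrix_def v_def g_def)
      also have "\<dots> = (\<Sum>h\<in>set vs. if (g, h) \<in> parcs G then of_int (sandwich id h) else 0)"
        by (rule sum.reindex_bij_betw[OF bij_betw_nth[OF vs(1) refl refl]])
      also have "\<dots> = (\<Sum>h\<in>(\<lambda>t. t \<circ> g) ` transps. of_int (sandwich id h))"
      proof -
        have "(\<lambda>t. t \<circ> g) ` transps \<subseteq> set vs"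
          using arcs[OF g] vs(2) by (auto simp: G_def cayley_graph_def)
        then have "{h \<in> set vs. (g, h) \<in> parcs G} = (\<lambda>t. t \<circ> g) ` transps"
          using arcs[OF g] by auto
        then show ?thesis by (simp flip: sum.inter_filter)
      qed
      also have "\<dots> = (\<Sum>t\<in>transps. of_int (sandwich id (t \<circ> g)))"
      proof (subst sum.reindex)
        show "inj_on (\<lambda>t. t \<circ> g) transps"
          by (rule inj_on_inverseI[where g = "\<lambda>u. u \<circ> inv' g"])
            (use g in \<open>simp add: comp_assoc permutes_inv_o\<close>)
      qed simp
      also have "\<dots> = of_int (k * sandwich id g)"
        unfolding k[symmetric] symmetrizer_eigenfunction[symmetric] by simp
      also have "\<dots> = (of_int k \<cdot>\<^sub>v v) $ i" using i by (simp add: v_def g_def)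
      finally show "(A *\<^sub>v v) $ i = (of_int k \<cdot>\<^sub>v v) $ i" .
    qed (simp add: dimA v_def)
    ultimately have "eigenvector A v (of_int k)"
      unfolding eigenvector_def using dimA by (auto simp: v_def)
    then show ?thesis unfolding eigenvalue_def A_def by blast
  qed
  have "finite (pverts G)" unfolding verts by (simp add: finite_permutations finite_S)
  then have "graph_eigenvalue G (of_int k)" unfolding graph_eigenvalue_def using eigen by blast
  then show ?thesis unfolding G_def k_def n_def .
qed

lemma Frobenius_coordinates_eigenvalue:
  fixes A B :: "nat set"
  assumes "finite A" "finite B" "card A = card B" "n = \<Sum>A + \<Sum>B + card A"
    and "m = (\<Sum>x\<in>A. int (Suc x choose 2)) - (\<Sum>y\<in>B. int (Suc y choose 2))"
  shows "graph_eigenvalue (cayley_graph (sym_group n) (transpositions n)) (of_int m)"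
  using down_closed_diagram_of_Frobenius_coordinates[OF assms(1-3)] content_sum_eigenvalue
    assms(4,5) by metis

theorem theorem3p2:
  fixes n :: nat and a :: nat and m :: int
  assumes "n \<ge> 27"
    and "3 \<le> a" and "int a \<le> \<lfloor>(real n - 15) / 3\<rfloor>"
    and "[int n - int a = 0] (mod 2)"
    and "m \<in> {int ((a - 1) choose 2) + 1 .. int (a choose 2)}"
  shows "graph_eigenvalue (cayley_graph (sym_group n) (transpositions n)) (real_of_int m)"
proof -
  have "real a \<le> (real n - 15) / 3" using assms(3) by (simp add: le_floor_iff)
  then have an: "3 * a + 15 \<le> n" by simp
  have "even (int n - int a)" using assms(4) by (simp add: cong_0_iff)
  \<comment> \<open>\<open>l\<close> is the value of \<open>v + z\<close> for which the coordinates
    \<open>(a - 1, v, z | v, z, 0)\<close> have size \<open>n\<close>.\<close>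
  then obtain l where l: "n = a + 2 + 2 * l"
  proof -
    assume *: "\<And>l. n = a + 2 + 2 * l \<Longrightarrow> thesis"
    have "n = a + 2 + 2 * ((n - a - 2) div 2)" using \<open>even (int n - int a)\<close> an by presburger
    then show thesis by (rule *)
  qed
  \<comment> \<open>This is what the constant 15 provides: as \<open>s\<close> is at most
    \<open>a - 2\<close>, it leaves \<open>l - s \<ge> 9\<close>, the bound for choosing
    \<open>v\<close> and \<open>z\<close>.\<close>
  have la: "l \<ge> a + 7" using an l by linarith
  \<comment> \<open>The distance of \<open>m\<close> from the top of the interval; the lower end of
    the interval gives \<open>s < a - 1\<close>.\<close>
  define s where "s = nat (int (a choose 2) - m)"
  have m: "m = int (a choose 2) - int s" using assms(5) by (simp add: s_def)
  obtain b where b: "a = Suc b" using assms(2) by (cases a) auto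
  have "a choose 2 = b + (b choose 2)" by (simp add: b numeral_2_eq_2)
  then have "s < b" using assms(5) m b by auto
  show ?thesis
  proof (cases s)
    case 0
    have "9 \<le> l" using la assms(2) by simp
    then obtain v z where vz: "v + z = l" "0 < v" "v < z" "{v, z} \<inter> {b, b, b} = {}"
      using distinct_summands_avoiding_three by blast
    show ?thesis
      \<comment> \<open>The contributions of \<open>v\<close> and \<open>z\<close> cancel and the
        coordinate 0 contributes \<open>1 choose 2\<close>, which is 0.\<close>
      by (rule Frobenius_coordinates_eigenvalue[of "{b, v, z}" "{v, z, 0}"])
        (use vz 0 m l b in \<open>auto simp: binomial_eq_0\<close>)
  next
    case (Suc u)
    \<comment> \<open>The additional pair \<open>u | u + 1\<close> adds \<open>2 * u + 2\<close> to
      the size, counting its diagonal cell, so \<open>v + z\<close> drops to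
      \<open>l - 1 - u\<close>. Avoiding \<open>u\<close>, \<open>Suc u\<close> and \<open>b\<close>
      keeps the coordinates on each side distinct.\<close>
    have "9 \<le> l - 1 - u" using la b Suc \<open>s < b\<close> by simp
    then obtain v z where vz: "v + z = l - 1 - u" "0 < v" "v < z" "{v, z} \<inter> {u, Suc u, b} = {}"
      using distinct_summands_avoiding_three by blast
    \<comment> \<open>The pair \<open>u | u + 1\<close> lowers the content sum by exactly
      \<open>u + 1 = s\<close>.\<close>
    have "int (Suc (Suc u) choose 2) = int (Suc u choose 2) + int s"
      by (simp add: Suc numeral_2_eq_2)
    then show ?thesis
      by (intro Frobenius_coordinates_eigenvalue[of "{b, u, v, z}" "{Suc u, v, z, 0}"])
        (use vz Suc m l b la \<open>s < b\<close> in \<open>auto simp: binomial_eq_0\<close>)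
  qed
qed

end
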